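(* Let $n,m>1$ be integers. If $G_{n,m,2}$ has exactly one diagonal, then $G_{n,m,2}$ is not Hamiltonian.
   Context: The graph $G_{n,m,2}$ (an augmented directed grid graph on a two-holed torus): its vertices are the $4nm$ cells $(i,c)$ of a grid with $2n$ rows $0\le i<2n$ (row $0$ on top) and $2m$ columns $0\le c<2m$ (column $0$ leftmost). The bijection $u$ ("up") on cells is $u(i,c)=(i-1,c)$ if $i\ge 1$, and $u(0,c)=(2n-1,(c+m)\bmod 2m)$. The bijection $r$ ("right") on cells is $r(i,c)=(i,c+1)$ if $c<2m-1$, and $r(i,2m-1)=((i+n)\bmod 2n,0)$. The directed edges are $(\alpha,u\alpha)$ and $(\alpha,r\alpha)$ for every cell $\alpha$. A diagonal is a set $\{\alpha,u^{-1}r\alpha,(u^{-1}r)^2\alpha,\dots\}$ for a cell $\alpha$, i.e. an orbit of the permutation $u^{-1}r$ (apply $r$ first, then $u^{-1}$) on cells. A directed graph is Hamiltonian if it has a directed cycle visiting every vertex exactly once. *)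

theory Defs
  imports "Graph_Theory.Pair_Digraph"
begin

type_synonym cell = "nat \<times> nat"

text \<open>A cell is a pair (row, column), row 0 being on top and column 0 leftmost.\<close>

definition cells :: "nat \<Rightarrow> nat \<Rightarrow> cell set" where
  "cells n m = {0..<2 * n} \<times> {0..<2 * m}"

text \<open>The values of \<open>up\<close> and \<open>right\<close> outside \<open>cells n m\<close> are irrelevant.\<close>

fun up :: "nat \<Rightarrow> nat \<Rightarrow> cell \<Rightarrow> cell" where
  "up n m (i, c) = (if i \<ge> 1 then (i - 1, c) else (2 * n - 1, (c + m) mod (2 * m)))"

fun right :: "nat \<Rightarrow> nat \<Rightarrow> cell \<Rightarrow> cell" where
  "right n m (i, c) = (if c < 2 * m - 1 then (i, c + 1) else ((i + n) mod (2 * n), 0))"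

lemma bij_betw_up: "bij_betw (up n m) (cells n m) (cells n m)"
proof -
  have "inj_on (up n m) (cells n m)"
    by (auto simp: inj_on_def cells_def mod_if split: if_splits)
  moreover have "up n m ` cells n m \<subseteq> cells n m"
    by (auto simp: cells_def split: if_splits)
  ultimately show ?thesis
    by (simp add: bij_betw_def endo_inj_surj cells_def)
qed

lemma bij_betw_right: "bij_betw (right n m) (cells n m) (cells n m)"
proof -
  have "inj_on (right n m) (cells n m)"
    by (auto simp: inj_on_def cells_def mod_if split: if_splits)
  moreover have "right n m ` cells n m \<subseteq> cells n m"
    by (auto simp: cells_def split: if_splits)
  ultimately show ?thesis
    by (simp add: bij_betw_def endo_inj_surj cells_def)
qed

definition grid_graph :: "nat \<Rightarrow> nat \<Rightarrow> cell pair_pre_digraph" where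
  "grid_graph n m =
    \<lparr> pverts = cells n m,
      parcs = {(\<alpha>, up n m \<alpha>) | \<alpha>. \<alpha> \<in> cells n m} \<union> {(\<alpha>, right n m \<alpha>) | \<alpha>. \<alpha> \<in> cells n m} \<rparr>"

text \<open>The two arcs leaving a cell never coincide if \<open>n, m > 1\<close>, so that a set of pairs
  loses no parallel arcs.\<close>

lemma up_neq_right:
  assumes "n > 1" "m > 1" "\<alpha> \<in> cells n m"
  shows "up n m \<alpha> \<noteq> right n m \<alpha>"
  using assms by (cases \<alpha>) (auto simp: cells_def mod_if split: if_splits)

lemma pair_wf_digraph_grid_graph: "pair_wf_digraph (grid_graph n m)"
  using bij_betwE[OF bij_betw_up] bij_betwE[OF bij_betw_right]
  by unfold_locales (auto simp: grid_graph_def simp del: up.simps right.simps)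

definition diag_step :: "nat \<Rightarrow> nat \<Rightarrow> cell \<Rightarrow> cell" where
  "diag_step n m = inv_into (cells n m) (up n m) \<circ> right n m"

definition diagonal :: "nat \<Rightarrow> nat \<Rightarrow> cell \<Rightarrow> cell set" where
  "diagonal n m \<alpha> = {(diag_step n m ^^ k) \<alpha> | k. True}"

definition diagonals :: "nat \<Rightarrow> nat \<Rightarrow> cell set set" where
  "diagonals n m = diagonal n m ` cells n m"

text \<open>The predicate \<open>pre_digraph.cycle\<close> already forbids repeated vertices; the vertices of
  a cycle are the tails of its arcs.\<close>

definition hamiltonian :: "('a, 'b) pre_digraph \<Rightarrow> bool" where
  "hamiltonian G \<longleftrightarrow> (\<exists>p. pre_digraph.cycle G p \<and> tail G ` set p = verts G)"

end

theory Submission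
  imports Defs
begin

text \<open>If a Hamiltonian cycle leaves \<open>\<alpha>\<close> to the right, it enters \<open>right \<alpha> = up (diag_step \<alpha>)\<close> from
  \<open>\<alpha>\<close>, so it cannot leave \<open>diag_step \<alpha>\<close> upwards. Thus the direction is constant along each
  diagonal, and with a single diagonal the whole cycle follows \<open>up\<close> or follows \<open>right\<close>. But \<open>up\<close>
  preserves the column modulo \<open>m\<close> and \<open>right\<close> preserves the row modulo \<open>n\<close>, so neither is
  transitive.\<close>

text \<open>Only the wrap-around at row 0 moves the column, and its shift by \<open>m\<close> modulo
  \<open>2 * m\<close> is invisible modulo \<open>m\<close>. For \<open>right\<close> the same
  happens with rows and \<open>n\<close>.\<close>

lemma snd_up_mod: "snd (up n m \<alpha>) mod m = snd \<alpha> mod m"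
  by (cases \<alpha>) (simp add: mod_mod_cancel)

lemma fst_right_mod: "fst (right n m \<alpha>) mod n = fst \<alpha> mod n"
  by (cases \<alpha>) (simp add: mod_mod_cancel)

lemma diag_step_in_cells:
  assumes "\<alpha> \<in> cells n m"
  shows "diag_step n m \<alpha> \<in> cells n m"
  unfolding diag_step_def comp_def
  using assms bij_betw_up bij_betw_right by (metis bij_betwE bij_betw_def inv_into_into)

lemma up_diag_step:
  assumes "\<alpha> \<in> cells n m"
  shows "up n m (diag_step n m \<alpha>) = right n m \<alpha>"
  unfolding diag_step_def comp_def
  using assms bij_betw_up bij_betw_right by (metis bij_betwE bij_betw_def f_inv_into_f)

text \<open>Every cell lies in its own diagonal, so a single diagonal consists of the iterates of
  \<open>diag_step\<close> at \<alpha>, and induction on the exponent reaches every cell.\<close>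

lemma single_diagonal_closed_set:
  assumes "card (diagonals n m) = 1" "\<alpha> \<in> cells n m" "\<alpha> \<in> R"
    and step: "\<And>\<beta>. \<beta> \<in> cells n m \<Longrightarrow> \<beta> \<in> R \<Longrightarrow> diag_step n m \<beta> \<in> R"
  shows "cells n m \<subseteq> R"
proof
  fix \<gamma> assume "\<gamma> \<in> cells n m"
  moreover obtain D where "diagonals n m = {D}"
    using assms(1) card_1_singletonE by blast
  ultimately have "diagonal n m \<gamma> = diagonal n m \<alpha>"
    using \<open>\<alpha> \<in> cells n m\<close> unfolding diagonals_def by blast
  moreover have "\<gamma> \<in> diagonal n m \<gamma>"
    unfolding diagonal_def by (auto intro: exI[of _ 0])
  ultimately obtain k where "\<gamma> = (diag_step n m ^^ k) \<alpha>"
    unfolding diagonal_def by blast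
  moreover have "(diag_step n m ^^ k) \<alpha> \<in> cells n m \<inter> R" for k
    by (induction k) (use assms diag_step_in_cells in auto)
  ultimately show "\<gamma> \<in> R" by blast
qed

text \<open>The head of each arc of a walk is the tail of the next, so the value at \<open>x\<close>
  is passed along.\<close>

lemma (in pre_digraph) cas_invariant:
  assumes "cas x p y" "\<And>e. e \<in> set p \<Longrightarrow> f (head G e) = f (tail G e)" "e \<in> set p"
  shows "f (tail G e) = f x"
  using assms by (induction p arbitrary: x) auto

theorem proposition12:
  fixes n m :: nat
  assumes "n > 1" and "m > 1"
    and "card (diagonals n m) = 1"
  shows "\<not> hamiltonian (with_proj (grid_graph n m))"
proof
  let ?G = "with_proj (grid_graph n m)"
  let ?u = "up n m" and ?r = "right n m" and ?C = "cells n m"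
  interpret wf_digraph ?G
    using pair_wf_digraph_grid_graph wf_digraph_wp_iff by blast
  assume "hamiltonian ?G"
  then obtain p x where walk: "awalk x p x" and dist: "distinct (tl (awalk_verts x p))"
    and tails: "fst ` set p = ?C"
    unfolding hamiltonian_def cycle_def by (auto simp: grid_graph_def)
  from walk have cas: "cas x p x" and arcs: "set p \<subseteq> parcs (grid_graph n m)"
    by (auto simp: awalk_def)
  \<comment> \<open>For nonempty \<open>p\<close>, dropping the first vertex of the walk leaves
    exactly the list of heads.\<close>
  have "inj_on snd (set p)"
    using dist awalk_verts_conv'[OF cas] by (auto simp: distinct_map split: if_splits)
  then have same_head: "\<alpha> = \<beta>" if "(\<alpha>, \<gamma>) \<in> set p" "(\<beta>, \<gamma>) \<in> set p" for \<alpha> \<beta> \<gamma>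
    using that by (metis inj_onD prod.inject snd_conv)
  have arc_cases: "\<gamma> = ?u \<alpha> \<or> \<gamma> = ?r \<alpha>" if "(\<alpha>, \<gamma>) \<in> set p" for \<alpha> \<gamma>
    using that arcs by (auto simp: grid_graph_def)
  have tail_in: "\<alpha> \<in> ?C" if "(\<alpha>, \<gamma>) \<in> set p" for \<alpha> \<gamma>
    using that tails by force
  \<comment> \<open>Every cell is a tail on the cycle, so a quantity kept by all its arcs takes one
    value on the whole grid.\<close>
  have const: "f \<alpha> = f \<beta>"
    if "\<And>\<alpha> \<gamma>. (\<alpha>, \<gamma>) \<in> set p \<Longrightarrow> f \<gamma> = f \<alpha>" "\<alpha> \<in> ?C" "\<beta> \<in> ?C" for f :: "cell \<Rightarrow> nat" and \<alpha> \<beta>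
  proof -
    have "f (fst e) = f x" if "e \<in> set p" for e
      using cas_invariant[OF cas, of f e] that \<open>\<And>\<alpha> \<gamma>. (\<alpha>, \<gamma>) \<in> set p \<Longrightarrow> f \<gamma> = f \<alpha>\<close> by auto
    with that(2,3) tails show ?thesis by (metis imageE)
  qed
  have corner: "(0, 0) \<in> ?C" "(0, 1) \<in> ?C" "(1, 0) \<in> ?C"
    using assms(1,2) by (auto simp: cells_def)
  define R where "R = {\<alpha>. (\<alpha>, ?r \<alpha>) \<in> set p}"
  have R_step: "diag_step n m \<alpha> \<in> R" if "\<alpha> \<in> ?C" "\<alpha> \<in> R" for \<alpha>
  proof (rule ccontr)
    let ?\<beta> = "diag_step n m \<alpha>"
    assume "?\<beta> \<notin> R"
    moreover obtain \<gamma> where "(?\<beta>, \<gamma>) \<in> set p"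
      using diag_step_in_cells[OF \<open>\<alpha> \<in> ?C\<close>] tails by (metis imageE prod.collapse)
    ultimately have "(?\<beta>, ?r \<alpha>) \<in> set p"
      using arc_cases up_diag_step[OF \<open>\<alpha> \<in> ?C\<close>] unfolding R_def by (metis mem_Collect_eq)
    \<comment> \<open>Both arcs enter \<open>?r \<alpha>\<close>. Equal tails would make the up and
      right arcs of \<alpha> coincide.\<close>
    then have "?\<beta> = \<alpha>"
      using same_head \<open>\<alpha> \<in> R\<close> unfolding R_def by blast
    then show False
      using up_diag_step up_neq_right assms(1,2) \<open>\<alpha> \<in> ?C\<close> by metis
  qed
  show False
  proof (cases "R = {}")
    case True
    then have "\<gamma> = ?u \<alpha>" if "(\<alpha>, \<gamma>) \<in> set p" for \<alpha> \<gamma>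
      using arc_cases that unfolding R_def by blast
    then have "snd \<gamma> mod m = snd \<alpha> mod m" if "(\<alpha>, \<gamma>) \<in> set p" for \<alpha> \<gamma>
      using that snd_up_mod by blast
    then have "snd (0::nat, 0::nat) mod m = snd (0::nat, 1::nat) mod m"
      by (rule const[OF _ corner(1,2)])
    with assms(2) show False by simp
  next
    case False
    then obtain \<alpha> where "\<alpha> \<in> ?C" "\<alpha> \<in> R"
      using tail_in unfolding R_def by blast
    then have R: "?C \<subseteq> R"
      using single_diagonal_closed_set[OF assms(3)] R_step by blast
    \<comment> \<open>The inclusion \<open>R\<close> puts all right arcs on the cycle but does not
      by itself exclude up arcs. Since \<open>?r\<close> is onto, every head is already entered by a
      right arc, and no second arc may enter it.\<close>
    have "\<gamma> = ?r \<alpha>" if arc: "(\<alpha>, \<gamma>) \<in> set p" for \<alpha> \<gamma>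
    proof -
      have "\<gamma> \<in> ?C"
        using arc_cases[OF arc] tail_in[OF arc] bij_betwE[OF bij_betw_up] bij_betwE[OF bij_betw_right]
        by blast
      then obtain \<beta> where "\<beta> \<in> ?C" "\<gamma> = ?r \<beta>"
        using bij_betw_right by (metis bij_betw_def imageE)
      with R same_head[OF arc, of \<beta>] show ?thesis
        unfolding R_def by blast
    qed
    then have "fst \<gamma> mod n = fst \<alpha> mod n" if "(\<alpha>, \<gamma>) \<in> set p" for \<alpha> \<gamma>
      using that fst_right_mod by blast
    then have "fst (0::nat, 0::nat) mod n = fst (1::nat, 0::nat) mod n"
      by (rule const[OF _ corner(1,3)])
    with assms(1) show False by simp
  qed
qed

end
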